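(* Let $X$ be the closed unit ball in $\ell_\infty^2$, that is, $X=[-1,1]\times[-1,1]$ with the metric $d((x,y),(x',y'))=\max(|x-x'|,|y-y'|)$. Then for any distinct starting positions of the lion and the man in $X$, in the lion and man game on $X$ the lion has a winning strategy and the man also has a winning strategy.
   Context: Lion and man game on a metric space $X$ with starting points $x_0$ (lion) and $y_0$ (man), $x_0\ne y_0$. A lion path is a function $l:[0,\infty)\to X$ with $d(l(s),l(t))\le |s-t|$ for all $s,t$ and $l(0)=x_0$; a man path is a function $m:[0,\infty)\to X$ with $d(m(s),m(t))\le|s-t|$ for all $s,t$ and $m(0)=y_0$. Let $L$ be the set of lion paths and $M$ the set of man paths. A lion strategy is a function $G:M\to L$ such that if $m,m'\in M$ agree on $[0,t]$ then $G(m)$ and $G(m')$ agree on $[0,t]$. A man strategy is a function $F:L\to M$ such that if $l,l'\in L$ agree on $[0,t]$ then $F(l)$ and $F(l')$ agree on $[0,t]$. A lion strategy $G$ is winning if for every $m\in M$ there is $t\ge 0$ with $G(m)(t)=m(t)$. A man strategy $F$ is winning if for every $l\in L$ and every $t\ge0$ we have $F(l)(t)\neq l(t)$. *)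

theory Defs
  imports "HOL-Analysis.Analysis"
begin

text \<open>
  The game is played on a set \<open>X\<close> with a metric \<open>d\<close>, in the style of the locale
  \<^locale>\<open>Metric_space\<close>. A function with domain \<open>[0,\<infinity>)\<close> is an extensional function on
  \<open>{0..}\<close>, so that two paths are equal iff they agree at all times \<open>t \<ge> 0\<close>. Lion paths are the
  paths starting at \<open>x0\<close>, and man paths are those starting at \<open>y0\<close>.
\<close>

definition paths :: "'a set \<Rightarrow> ('a \<Rightarrow> 'a \<Rightarrow> real) \<Rightarrow> 'a \<Rightarrow> (real \<Rightarrow> 'a) set" where
  "paths X d p =
     {l \<in> {0..} \<rightarrow>\<^sub>E X. (\<forall>s\<ge>0. \<forall>t\<ge>0. d (l s) (l t) \<le> \<bar>s - t\<bar>) \<and> l 0 = p}"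

definition agree_upto :: "real \<Rightarrow> (real \<Rightarrow> 'a) \<Rightarrow> (real \<Rightarrow> 'a) \<Rightarrow> bool" where
  "agree_upto t f g \<longleftrightarrow> (\<forall>s\<in>{0..t}. f s = g s)"

definition lion_strategy ::
    "'a set \<Rightarrow> ('a \<Rightarrow> 'a \<Rightarrow> real) \<Rightarrow> 'a \<Rightarrow> 'a \<Rightarrow> ((real \<Rightarrow> 'a) \<Rightarrow> (real \<Rightarrow> 'a)) \<Rightarrow> bool" where
  "lion_strategy X d x0 y0 G \<longleftrightarrow>
     G \<in> paths X d y0 \<rightarrow> paths X d x0 \<and>
     (\<forall>m\<in>paths X d y0. \<forall>m'\<in>paths X d y0. \<forall>t\<ge>0.
        agree_upto t m m' \<longrightarrow> agree_upto t (G m) (G m'))"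

definition man_strategy ::
    "'a set \<Rightarrow> ('a \<Rightarrow> 'a \<Rightarrow> real) \<Rightarrow> 'a \<Rightarrow> 'a \<Rightarrow> ((real \<Rightarrow> 'a) \<Rightarrow> (real \<Rightarrow> 'a)) \<Rightarrow> bool" where
  "man_strategy X d x0 y0 F \<longleftrightarrow>
     F \<in> paths X d x0 \<rightarrow> paths X d y0 \<and>
     (\<forall>l\<in>paths X d x0. \<forall>l'\<in>paths X d x0. \<forall>t\<ge>0.
        agree_upto t l l' \<longrightarrow> agree_upto t (F l) (F l'))"

definition winning_lion_strategy ::
    "'a set \<Rightarrow> ('a \<Rightarrow> 'a \<Rightarrow> real) \<Rightarrow> 'a \<Rightarrow> 'a \<Rightarrow> ((real \<Rightarrow> 'a) \<Rightarrow> (real \<Rightarrow> 'a)) \<Rightarrow> bool" where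
  "winning_lion_strategy X d x0 y0 G \<longleftrightarrow>
     lion_strategy X d x0 y0 G \<and> (\<forall>m\<in>paths X d y0. \<exists>t\<ge>0. G m t = m t)"

definition winning_man_strategy ::
    "'a set \<Rightarrow> ('a \<Rightarrow> 'a \<Rightarrow> real) \<Rightarrow> 'a \<Rightarrow> 'a \<Rightarrow> ((real \<Rightarrow> 'a) \<Rightarrow> (real \<Rightarrow> 'a)) \<Rightarrow> bool" where
  "winning_man_strategy X d x0 y0 F \<longleftrightarrow>
     man_strategy X d x0 y0 F \<and> (\<forall>l\<in>paths X d x0. \<forall>t\<ge>0. F l t \<noteq> l t)"

text \<open>
  The class metric \<^const>\<open>dist\<close> on \<^typ>\<open>real \<times> real\<close> is Euclidean, hence the explicit metric.
\<close>

definition linf_dist :: "real \<times> real \<Rightarrow> real \<times> real \<Rightarrow> real" where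
  "linf_dist p q = max \<bar>fst p - fst q\<bar> \<bar>snd p - snd q\<bar>"

definition linf_ball :: "(real \<times> real) set" where
  "linf_ball = {-1..1} \<times> {-1..1}"

lemma Metric_space_linf: "Metric_space X linf_dist"
  by standard (auto simp: linf_dist_def max_def abs_if prod_eq_iff)

lemma linf_ball_eq_mcball: "linf_ball = Metric_space.mcball UNIV linf_dist (0, 0) 1"
  unfolding Metric_space.mcball_def[OF Metric_space_linf]
  by (auto simp: linf_ball_def linf_dist_def)

end

theory Submission
  imports Defs
begin

text \<open>
  Both winning strategies rest on the fact that, in the maximum metric, a path is nothing but
  a pair of independent 1-Lipschitz coordinate functions.

  The lion runs towards the man at full speed in each coordinate separately. Once he has the
  same coordinate as the man he can keep it for ever, because the man is no faster. Clamping the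
  man's coordinate \<open>u t\<close> to the interval \<open>[a - t, a + t]\<close> that the lion can have reached from \<open>a\<close>
  expresses this in one formula (\<open>chase\<close>). The ball has diameter 2, so from time 2 on the
  clamping has no effect in either coordinate, and the lion is at the man's position.

  The man exploits that his position at a time \<open>S + s\<close> with \<open>s > 0\<close> may depend on the lion's
  path on \<open>[0, S + s]\<close>, and hence on how the lion starts to move immediately after \<open>S\<close>. Suppose
  that the man has room to move by \<open>h\<close> in both directions in one coordinate, starting at \<open>c\<close>. He
  moves downwards if the lion's coordinate is at least \<open>c + s\<close> at all times \<open>S + s\<close> in some
  interval after \<open>S\<close>, and upwards otherwise. In both cases the lion's coordinate
  differs from his during the whole run, even if they were equal at time \<open>S\<close>
  (\<open>run_avoids_pursuer\<close>). During his next run, which uses the other coordinate in the same way, he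
  brings the first one back to \<open>c\<close>. So he has enough room for ever, although he never learns
  anything in advance: at each instant after the start of the first run, one of the two coordinates is being
  used to evade the lion.
  It remains to reach a point at distance at least \<open>h\<close> from the boundary before the
  first run. A third of the initial distance is a suitable \<open>h\<close>, since in time \<open>h\<close> the
  gap shrinks by at most \<open>2 * h\<close>.

  The two strategies do not contradict each other: both react without delay, so no pair of paths
  needs to exist in which each is the reply to the other.
\<close>

section \<open>Paths as pairs of Lipschitz functions\<close>

lemma paths_linf_coordinate:
  assumes "l \<in> paths linf_ball linf_dist p" and "\<pi> = fst \<or> \<pi> = snd"
  shows "1-lipschitz_on {0..} (\<lambda>t. \<pi> (l t))" and "\<pi> (l 0) = \<pi> p"
    and "t \<ge> 0 \<Longrightarrow> \<bar>\<pi> (l t)\<bar> \<le> 1"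
proof -
  show "1-lipschitz_on {0..} (\<lambda>t. \<pi> (l t))"
    using assms unfolding lipschitz_on_def paths_def linf_dist_def dist_real_def by force
  show "\<pi> (l 0) = \<pi> p"
    using assms by (auto simp: paths_def)
  assume "t \<ge> 0"
  then have "l t \<in> linf_ball"
    using assms(1) by (auto simp: paths_def)
  then show "\<bar>\<pi> (l t)\<bar> \<le> 1"
    using assms(2) by (auto simp: linf_ball_def mem_Times_iff)
qed

lemma pair_in_paths_linf:
  assumes "1-lipschitz_on {0..} f" and "1-lipschitz_on {0..} g"
    and "\<And>t. t \<ge> 0 \<Longrightarrow> \<bar>f t\<bar> \<le> 1" and "\<And>t. t \<ge> 0 \<Longrightarrow> \<bar>g t\<bar> \<le> 1"
    and "f 0 = fst p" and "g 0 = snd p"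
  shows "(\<lambda>t\<in>{0..}. (f t, g t)) \<in> paths linf_ball linf_dist p"
proof -
  have "linf_dist (f s, g s) (f t, g t) \<le> \<bar>s - t\<bar>" if "s \<ge> 0" "t \<ge> 0" for s t
    using that lipschitz_onD[OF assms(1), of s t] lipschitz_onD[OF assms(2), of s t]
    by (simp add: linf_dist_def dist_real_def)
  moreover have "(f t, g t) \<in> linf_ball" if "t \<ge> 0" for t
    using assms(3,4)[OF that] by (auto simp: linf_ball_def abs_le_iff)
  ultimately show ?thesis
    using assms(5,6) by (simp add: paths_def)
qed

lemma lipschitz_on_real_ordI:
  fixes f :: "real \<Rightarrow> real"
  assumes "\<And>s t. s \<in> A \<Longrightarrow> t \<in> A \<Longrightarrow> s \<le> t \<Longrightarrow> \<bar>f s - f t\<bar> \<le> t - s"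
  shows "1-lipschitz_on A f"
proof (rule lipschitz_onI)
  fix s t
  assume "s \<in> A" "t \<in> A"
  then show "dist (f s) (f t) \<le> 1 * dist s t"
    using assms[of s t] assms[of t s]
    by (cases "s \<le> t") (auto simp: dist_real_def abs_minus_commute)
qed simp

section \<open>The lion's strategy\<close>

definition chase :: "real \<Rightarrow> (real \<Rightarrow> real) \<Rightarrow> real \<Rightarrow> real" where
  "chase a u t = max (a - t) (min (a + t) (u t))"

lemma chase_lipschitz:
  assumes "1-lipschitz_on {0..} u"
  shows "1-lipschitz_on {0..} (chase a u)"
proof (rule lipschitz_on_real_ordI)
  fix s t :: real
  assume "s \<in> {0..}" "t \<in> {0..}" "s \<le> t"
  then have "\<bar>u s - u t\<bar> \<le> t - s"
    using lipschitz_onD[OF assms, of s t] by (simp add: dist_real_def)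
  then have "\<bar>min (a + s) (u s) - min (a + t) (u t)\<bar> \<le> t - s"
    using \<open>s \<le> t\<close> by linarith
  then show "\<bar>chase a u s - chase a u t\<bar> \<le> t - s"
    using \<open>s \<le> t\<close> unfolding chase_def by linarith
qed

lemma chase_bounded:
  assumes "\<bar>a\<bar> \<le> 1" "\<bar>u t\<bar> \<le> 1" "t \<ge> 0"
  shows "\<bar>chase a u t\<bar> \<le> 1"
  using assms unfolding chase_def by linarith

lemma chase_catches:
  assumes "\<bar>a\<bar> \<le> 1" "\<bar>u t\<bar> \<le> 1" "t \<ge> 2"
  shows "chase a u t = u t"
  using assms unfolding chase_def by linarith

definition lion_chase :: "real \<times> real \<Rightarrow> (real \<Rightarrow> real \<times> real) \<Rightarrow> real \<Rightarrow> real \<times> real" where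
  "lion_chase p m =
     (\<lambda>t\<in>{0..}. (chase (fst p) (\<lambda>t. fst (m t)) t, chase (snd p) (\<lambda>t. snd (m t)) t))"

lemma lion_chase_winning:
  assumes "p \<in> linf_ball"
  shows "winning_lion_strategy linf_ball linf_dist p q (lion_chase p)"
proof -
  have p: "\<bar>fst p\<bar> \<le> 1" "\<bar>snd p\<bar> \<le> 1"
    using assms by (auto simp: linf_ball_def)
  have "lion_chase p m \<in> paths linf_ball linf_dist p" if "m \<in> paths linf_ball linf_dist q" for m
    unfolding lion_chase_def
    by (intro pair_in_paths_linf chase_lipschitz chase_bounded p paths_linf_coordinate[OF that])
       (auto simp: chase_def)
  moreover have "agree_upto t (lion_chase p m) (lion_chase p m')" if "agree_upto t m m'" for t m m'
    using that by (auto simp: agree_upto_def lion_chase_def chase_def)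
  moreover have "lion_chase p m 2 = m 2" if "m \<in> paths linf_ball linf_dist q" for m
    by (simp add: lion_chase_def chase_catches p paths_linf_coordinate(3)[OF that])
  ultimately show ?thesis
    unfolding winning_lion_strategy_def lion_strategy_def
    by (meson Pi_I zero_le_numeral)
qed

section \<open>A single evasive run\<close>

definition run_direction :: "real \<Rightarrow> real \<Rightarrow> (real \<Rightarrow> real) \<Rightarrow> real" where
  "run_direction c S u = (if \<exists>\<delta>>0. \<forall>s\<in>{0<..\<delta>}. c + s \<le> u (S + s) then -1 else 1)"

lemma abs_run_direction [simp]: "\<bar>run_direction c S u\<bar> = 1"
  by (simp add: run_direction_def)

text \<open>
  Any initial segment of the interval after \<open>S\<close> decides the direction, because the \<open>\<delta>\<close> in its
  definition can be decreased.
\<close>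

lemma run_direction_cong:
  assumes "S < t" and "\<And>s. S < s \<Longrightarrow> s \<le> t \<Longrightarrow> u s = v s"
  shows "run_direction c S u = run_direction c S v"
proof -
  have "\<exists>\<delta>>0. \<forall>s\<in>{0<..\<delta>}. c + s \<le> g (S + s)"
    if "\<delta> > 0" "\<forall>s\<in>{0<..\<delta>}. c + s \<le> f (S + s)" "\<And>s. S < s \<Longrightarrow> s \<le> t \<Longrightarrow> f s = g s"
    for \<delta> and f g :: "real \<Rightarrow> real"
  proof (intro exI[of _ "min \<delta> (t - S)"] conjI ballI)
    show "min \<delta> (t - S) > 0"
      using that(1) assms(1) by simp
    fix s assume s: "s \<in> {0<..min \<delta> (t - S)}"
    then have "f (S + s) = g (S + s)"
      by (intro that(3)) auto
    then show "c + s \<le> g (S + s)"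
      using that(2) s by (metis greaterThanAtMost_iff min.bounded_iff)
  qed
  from this[of _ u v] this[of _ v u] assms(2) show ?thesis
    unfolding run_direction_def by (smt (verit))
qed

text \<open>
  If the man runs downwards, then the pursuer is strictly above him at some moment after \<open>S\<close>, which
  can be chosen arbitrarily early. If he runs upwards, then the pursuer is strictly below him at
  some such moment. In both cases the man moves away from the pursuer at the maximal speed, so
  the gap cannot shrink during the rest of the run.
\<close>

lemma run_avoids_pursuer:
  assumes u: "1-lipschitz_on {0..} u" and "S \<ge> 0" and "r > 0"
  shows "u (S + r) \<noteq> c + run_direction c S u * r"
proof -
  have lip: "\<bar>u (S + s) - u (S + r)\<bar> \<le> r - s" if "0 < s" "s \<le> r" for s
    using lipschitz_onD[OF u, of "S + s" "S + r"] that \<open>S \<ge> 0\<close> by (simp add: dist_real_def)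
  show ?thesis
  proof (cases "\<exists>\<delta>>0. \<forall>s\<in>{0<..\<delta>}. c + s \<le> u (S + s)")
    case True
    then obtain \<delta> where \<delta>: "\<delta> > 0" "\<And>s. 0 < s \<Longrightarrow> s \<le> \<delta> \<Longrightarrow> c + s \<le> u (S + s)"
      by auto
    define s where "s = min \<delta> r"
    have s: "0 < s" "s \<le> r" "s \<le> \<delta>"
      using \<delta>(1) \<open>r > 0\<close> by (auto simp: s_def)
    have "c - r < u (S + r)"
      using lip[OF s(1,2)] \<delta>(2)[OF s(1,3)] s(1) by linarith
    moreover have "run_direction c S u = -1"
      using True unfolding run_direction_def by (simp only: if_True)
    ultimately show ?thesis
      by simp
  next
    case False
    with \<open>r > 0\<close> obtain s where s: "0 < s" "s \<le> r" "u (S + s) < c + s"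
      by (metis greaterThanAtMost_iff not_le)
    have "u (S + r) < c + r"
      using lip[OF s(1,2)] s(3) by linarith
    moreover have "run_direction c S u = 1"
      using False unfolding run_direction_def by (simp only: if_False)
    ultimately show ?thesis
      by simp
  qed
qed

section \<open>Periodic runs in one coordinate\<close>

definition period_start :: "real \<Rightarrow> real \<Rightarrow> real \<Rightarrow> real" where
  "period_start h S\<^sub>0 t = S\<^sub>0 + 2 * h * \<lfloor>(t - S\<^sub>0) / (2 * h)\<rfloor>"

lemma period_start_bounds:
  assumes "h > 0"
  shows "period_start h S\<^sub>0 t \<le> t" and "t < period_start h S\<^sub>0 t + 2 * h"
proof -
  define x where "x = (t - S\<^sub>0) / (2 * h)"
  have t: "t = S\<^sub>0 + 2 * h * x" and S: "period_start h S\<^sub>0 t = S\<^sub>0 + 2 * h * \<lfloor>x\<rfloor>"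
    using assms by (simp_all add: x_def period_start_def)
  have "2 * h * \<lfloor>x\<rfloor> \<le> 2 * h * x" "2 * h * x < 2 * h * (\<lfloor>x\<rfloor> + 1)"
    using assms by (intro mult_left_mono mult_strict_left_mono; linarith)+
  then show "period_start h S\<^sub>0 t \<le> t" "t < period_start h S\<^sub>0 t + 2 * h"
    unfolding S using t by (simp_all add: algebra_simps)
qed

lemma period_start_ge:
  assumes "h > 0" "S\<^sub>0 \<le> t"
  shows "S\<^sub>0 \<le> period_start h S\<^sub>0 t"
  using assms by (simp add: period_start_def)

lemma period_start_eqI:
  assumes "h > 0" "S\<^sub>0 + 2 * h * real k \<le> t" "t < S\<^sub>0 + 2 * h * real k + 2 * h"
  shows "period_start h S\<^sub>0 t = S\<^sub>0 + 2 * h * real k"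
proof -
  have "\<lfloor>(t - S\<^sub>0) / (2 * h)\<rfloor> = int k"
    using assms by (intro floor_unique) (simp_all add: field_simps)
  then show ?thesis
    by (simp add: period_start_def)
qed

lemma period_start_next:
  assumes "h > 0" "s \<le> t" "period_start h S\<^sub>0 s \<noteq> period_start h S\<^sub>0 t"
  shows "period_start h S\<^sub>0 s + 2 * h \<le> period_start h S\<^sub>0 t"
proof -
  define i j where "i = \<lfloor>(s - S\<^sub>0) / (2 * h)\<rfloor>" and "j = \<lfloor>(t - S\<^sub>0) / (2 * h)\<rfloor>"
  have "i \<le> j"
    unfolding i_def j_def using assms(1,2) by (intro floor_mono divide_right_mono) auto
  moreover have "i \<noteq> j"
    using assms(3) by (auto simp: period_start_def i_def j_def)
  ultimately have "real_of_int i + 1 \<le> real_of_int j"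
    by linarith
  then have "2 * h * (real_of_int i + 1) \<le> 2 * h * real_of_int j"
    using assms(1) by (intro mult_left_mono) auto
  then show ?thesis
    by (simp add: period_start_def i_def j_def algebra_simps)
qed

text \<open>
  The displacement is a sequence of tents of height \<open>h\<close>, starting at time \<open>S\<^sub>0\<close>: in the first half
  of each period of length \<open>2 * h\<close> the man runs away from \<open>c\<close>, in the second half he returns.
\<close>

definition excursion :: "real \<Rightarrow> real \<Rightarrow> real \<Rightarrow> (real \<Rightarrow> real) \<Rightarrow> real \<Rightarrow> real" where
  "excursion h S\<^sub>0 c u t =
     (if t < S\<^sub>0 then 0
      else run_direction c (period_start h S\<^sub>0 t) u * (h - \<bar>t - period_start h S\<^sub>0 t - h\<bar>))"

lemma abs_excursion:
  assumes "h > 0" "S\<^sub>0 \<le> t"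
  shows "\<bar>excursion h S\<^sub>0 c u t\<bar> = h - \<bar>t - period_start h S\<^sub>0 t - h\<bar>"
  using assms period_start_bounds[OF assms(1), where t = t and S\<^sub>0 = S\<^sub>0]
  by (simp add: excursion_def abs_mult)

lemma abs_excursion_le:
  assumes "h > 0"
  shows "\<bar>excursion h S\<^sub>0 c u t\<bar> \<le> h"
  using assms abs_excursion[OF assms, of S\<^sub>0 t c u] by (cases "t < S\<^sub>0") (auto simp: excursion_def)

text \<open>
  Different periods may use different directions, but the displacement vanishes between
  them, at the start \<open>S\<close> of the later period. Hence two times in different
  periods are compared by way of \<open>S\<close>.
\<close>

lemma excursion_lipschitz:
  assumes h: "h > 0"
  shows "1-lipschitz_on A (excursion h S\<^sub>0 c u)"
proof -
  let ?e = "excursion h S\<^sub>0 c u"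
  have "\<bar>?e s - ?e t\<bar> \<le> t - s" if "s \<le> t" for s t
  proof (cases "t < S\<^sub>0")
    case True
    with that show ?thesis by (simp add: excursion_def)
  next
    case False
    define S where "S = period_start h S\<^sub>0 t"
    have et: "\<bar>?e t\<bar> \<le> t - S" and S: "S\<^sub>0 \<le> S"
      using abs_excursion[OF h, of S\<^sub>0 t c u] period_start_ge[OF h, of S\<^sub>0 t] False
      by (auto simp: S_def)
    show ?thesis
    proof (cases "s < S\<^sub>0")
      case True
      then have "?e s = 0"
        by (simp add: excursion_def)
      with et S True show ?thesis by linarith
    next
      case s: False
      show ?thesis
      proof (cases "period_start h S\<^sub>0 s = S")
        case True
        then have "\<bar>?e s - ?e t\<bar>
            = \<bar>run_direction c S u * ((h - \<bar>s - S - h\<bar>) - (h - \<bar>t - S - h\<bar>))\<bar>"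
          using s \<open>\<not> t < S\<^sub>0\<close> by (simp add: excursion_def S_def right_diff_distrib)
        also have "\<dots> \<le> t - s"
          using that by (simp add: abs_mult)
        finally show ?thesis .
      next
        case False
        then have "period_start h S\<^sub>0 s + 2 * h \<le> S"
          using period_start_next[OF h that] by (simp add: S_def)
        moreover have "\<bar>?e s\<bar> \<le> period_start h S\<^sub>0 s + 2 * h - s"
          using abs_excursion[OF h, of S\<^sub>0 s c u] s by auto
        ultimately show ?thesis
          using et by linarith
      qed
    qed
  qed
  then show ?thesis
    by (intro lipschitz_on_real_ordI)
qed

text \<open>
  At the start of a period the direction is still undetermined by the past, but there the
  displacement is zero in either direction.
\<close>

lemma excursion_cong:
  assumes "h > 0" "S\<^sub>0 \<ge> 0" and "\<And>s. 0 \<le> s \<Longrightarrow> s \<le> t \<Longrightarrow> u s = v s"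
  shows "excursion h S\<^sub>0 c u t = excursion h S\<^sub>0 c v t"
proof (cases "t < S\<^sub>0 \<or> t = period_start h S\<^sub>0 t")
  case True
  then show ?thesis
    using \<open>h > 0\<close> by (auto simp: excursion_def)
next
  case False
  let ?S = "period_start h S\<^sub>0 t"
  have "?S < t" "0 \<le> ?S"
    using False period_start_bounds(1)[OF \<open>h > 0\<close>, of S\<^sub>0 t] period_start_ge[OF \<open>h > 0\<close>, of S\<^sub>0 t]
      \<open>S\<^sub>0 \<ge> 0\<close> by auto
  then have "run_direction c ?S u = run_direction c ?S v"
    using assms(3) by (intro run_direction_cong[of _ t]) auto
  then show ?thesis
    by (simp add: excursion_def)
qed

lemma excursion_avoids_pursuer:
  assumes "h > 0" "S\<^sub>0 \<ge> 0" and u: "1-lipschitz_on {0..} u"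
    and t: "S\<^sub>0 + 2 * h * real k < t" "t \<le> S\<^sub>0 + 2 * h * real k + h"
  shows "u t \<noteq> c + excursion h S\<^sub>0 c u t"
proof -
  define S where "S = S\<^sub>0 + 2 * h * real k"
  have S: "period_start h S\<^sub>0 t = S"
    unfolding S_def using assms by (intro period_start_eqI) auto
  have "S\<^sub>0 \<le> S"
    using \<open>h > 0\<close> by (simp add: S_def)
  then have "excursion h S\<^sub>0 c u t = run_direction c S u * (t - S)"
    using t by (simp add: excursion_def S flip: S_def)
  then show ?thesis
    using run_avoids_pursuer[OF u, of S "t - S" c] \<open>S\<^sub>0 \<le> S\<close> \<open>S\<^sub>0 \<ge> 0\<close> t(1) by (simp add: S_def)
qed

section \<open>The man's strategy\<close>

text \<open>
  Up to time \<open>h\<close> the man scales his starting coordinate \<open>q\<close> down by the factor \<open>1 - h\<close>, which leaves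
  room \<open>h\<close> on both sides. All excursions start from this coordinate.
\<close>

definition evade :: "real \<Rightarrow> real \<Rightarrow> real \<Rightarrow> (real \<Rightarrow> real) \<Rightarrow> real \<Rightarrow> real" where
  "evade h S\<^sub>0 q u t = (1 - min t h) * q + excursion h S\<^sub>0 ((1 - h) * q) u t"

lemma evade_lipschitz:
  assumes h: "0 < h" and S\<^sub>0: "h \<le> S\<^sub>0" and q: "\<bar>q\<bar> \<le> 1"
  shows "1-lipschitz_on {0..} (evade h S\<^sub>0 q u)"
proof -
  let ?e = "excursion h S\<^sub>0 ((1 - h) * q) u"
  have exc: "\<bar>?e s - ?e t\<bar> \<le> \<bar>s - t\<bar>" for s t
    using lipschitz_onD[OF excursion_lipschitz[OF h, of UNIV], of s t] by (simp add: dist_real_def)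
  have zero: "?e s = 0" if "s \<le> h" for s
    \<comment> \<open>The first tent starts with height 0 in case \<open>s = h = S\<^sub>0\<close>.\<close>
    using that S\<^sub>0 h by (cases "s = S\<^sub>0") (auto simp: excursion_def period_start_def)
  have drift: "\<bar>(1 - min s h) * q - (1 - min t h) * q\<bar> \<le> \<bar>min s h - min t h\<bar>" for s t
    using q mult_left_mono[OF q, of "\<bar>min s h - min t h\<bar>"]
    by (simp add: abs_mult abs_minus_commute flip: left_diff_distrib)
  have "\<bar>evade h S\<^sub>0 q u s - evade h S\<^sub>0 q u t\<bar> \<le> t - s" if "s \<le> t" for s t
  proof -
    consider "t \<le> h" | "s \<le> h" "h \<le> t" | "h \<le> s"
      by linarith
    then show ?thesis
    proof cases
      case 1
      then show ?thesis
        using that drift[of s t] zero[of s] zero[of t] by (simp add: evade_def)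
    next
      case 2
      then show ?thesis
        using drift[of s t] exc[of h t] zero[of s] zero[of h] by (simp add: evade_def)
    next
      case 3
      then show ?thesis
        using that exc[of s t] by (simp add: evade_def)
    qed
  qed
  then show ?thesis
    by (intro lipschitz_on_real_ordI)
qed

lemma evade_bounded:
  assumes h: "0 < h" "h \<le> 1" and "h \<le> S\<^sub>0" and q: "\<bar>q\<bar> \<le> 1" and "t \<ge> 0"
  shows "\<bar>evade h S\<^sub>0 q u t\<bar> \<le> 1"
proof -
  have "\<bar>(1 - min t h) * q\<bar> \<le> 1 - min t h"
    using mult_left_mono[OF q, of "1 - min t h"] h by (simp add: abs_mult)
  moreover have "\<bar>excursion h S\<^sub>0 ((1 - h) * q) u t\<bar> \<le> min t h"
    using abs_excursion_le[OF h(1)] assms by (cases "t < h") (auto simp: excursion_def)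
  ultimately show ?thesis
    unfolding evade_def by linarith
qed

lemma evade_cong:
  assumes "h > 0" "S\<^sub>0 \<ge> 0" and "\<And>s. 0 \<le> s \<Longrightarrow> s \<le> t \<Longrightarrow> u s = v s"
  shows "evade h S\<^sub>0 q u t = evade h S\<^sub>0 q v t"
  using excursion_cong[OF assms] by (simp add: evade_def)

text \<open>
  The excursions of the second coordinate start half a period later, so that in each time interval
  \<open>(n * h, (n + 1) * h]\<close> with \<open>n \<ge> 1\<close> one of the coordinates is on an outward run.
\<close>

definition man_evade :: "real \<Rightarrow> real \<times> real \<Rightarrow> (real \<Rightarrow> real \<times> real) \<Rightarrow> real \<Rightarrow> real \<times> real" where
  "man_evade h q l =
     (\<lambda>t\<in>{0..}. (evade h h (fst q) (\<lambda>t. fst (l t)) t, evade h (2 * h) (snd q) (\<lambda>t. snd (l t)) t))"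

lemma man_evade_in_paths:
  assumes "0 < h" "h \<le> 1" and "q \<in> linf_ball"
  shows "man_evade h q l \<in> paths linf_ball linf_dist q"
proof -
  have q: "\<bar>fst q\<bar> \<le> 1" "\<bar>snd q\<bar> \<le> 1"
    using assms(3) by (auto simp: linf_ball_def)
  show ?thesis
    unfolding man_evade_def using assms(1,2)
    by (intro pair_in_paths_linf evade_lipschitz evade_bounded q)
       (auto simp: evade_def excursion_def)
qed

lemma man_evade_cong:
  assumes "0 < h" and "agree_upto t l l'"
  shows "agree_upto t (man_evade h q l) (man_evade h q l')"
  using assms by (auto simp: agree_upto_def man_evade_def intro!: evade_cong)

lemma man_evade_avoids_lion:
  assumes h: "0 < h" "h \<le> 1" "2 * h < linf_dist p q" and q: "q \<in> linf_ball"
    and l: "l \<in> paths linf_ball linf_dist p" and "t \<ge> 0"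
  shows "man_evade h q l t \<noteq> l t"
proof (cases "t \<le> h")
  case True
  have "linf_dist (l t) (l 0) \<le> t" "linf_dist (man_evade h q l t) (man_evade h q l 0) \<le> t"
    using l man_evade_in_paths[OF h(1,2) q, of l] \<open>t \<ge> 0\<close> by (fastforce simp: paths_def)+
  moreover have "l 0 = p" "man_evade h q l 0 = q"
    using l man_evade_in_paths[OF h(1,2) q, of l] by (auto simp: paths_def)
  ultimately show ?thesis
    using True h(3) unfolding linf_dist_def by auto
next
  case False
  \<comment> \<open>The interval \<open>(n * h, (n + 1) * h]\<close> that contains \<open>t\<close>; the parity of \<open>n\<close> tells which coordinate
     is on an outward run.\<close>
  define n where "n = nat (\<lceil>t / h\<rceil> - 1)"
  have "t / h > 1"
    using False h(1) by (simp add: field_simps)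
  then have n: "real n < t / h" "t / h \<le> real n + 1" "n \<ge> 1"
    unfolding n_def by linarith+
  then have t: "h * real n < t" "t \<le> h * real n + h"
    using h(1) by (simp_all add: field_simps)
  show ?thesis
  proof (cases "odd n")
    case True
    then obtain k where "n = 2 * k + 1"
      by (elim oddE)
    with t have "fst (l t) \<noteq> (1 - h) * fst q
        + excursion h h ((1 - h) * fst q) (\<lambda>t. fst (l t)) t"
      using h(1) paths_linf_coordinate(1)[OF l]
      by (intro excursion_avoids_pursuer[of h h _ k]) (auto simp: algebra_simps)
    then show ?thesis
      using False \<open>t \<ge> 0\<close> by (auto simp: man_evade_def evade_def prod_eq_iff)
  next
    case even: False
    then obtain j where "n = 2 * j"
      by (metis evenE)
    with \<open>n \<ge> 1\<close> obtain k where "n = 2 * k + 2"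
      by (cases j) auto
    with t have "snd (l t) \<noteq> (1 - h) * snd q
        + excursion h (2 * h) ((1 - h) * snd q) (\<lambda>t. snd (l t)) t"
      using h(1) paths_linf_coordinate(1)[OF l]
      by (intro excursion_avoids_pursuer[of h "2 * h" _ k]) (auto simp: algebra_simps)
    then show ?thesis
      using False \<open>t \<ge> 0\<close> by (auto simp: man_evade_def evade_def prod_eq_iff)
  qed
qed

lemma man_evade_winning:
  assumes "0 < h" "h \<le> 1" "2 * h < linf_dist p q" and "q \<in> linf_ball"
  shows "winning_man_strategy linf_ball linf_dist p q (man_evade h q)"
  unfolding winning_man_strategy_def man_strategy_def
  using assms man_evade_in_paths man_evade_cong man_evade_avoids_lion by blast

theorem theorem9:
  fixes x0 y0 :: "real \<times> real"
  assumes "x0 \<in> linf_ball" and "y0 \<in> linf_ball" and "x0 \<noteq> y0"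
  shows "(\<exists>G. winning_lion_strategy linf_ball linf_dist x0 y0 G) \<and>
         (\<exists>F. winning_man_strategy linf_ball linf_dist x0 y0 F)"
proof
  show "\<exists>G. winning_lion_strategy linf_ball linf_dist x0 y0 G"
    using lion_chase_winning[OF assms(1)] by blast
  have "0 < linf_dist x0 y0" "linf_dist x0 y0 \<le> 2"
    using assms by (auto simp: linf_dist_def linf_ball_def prod_eq_iff)
  then have "winning_man_strategy linf_ball linf_dist x0 y0 (man_evade (linf_dist x0 y0 / 3) y0)"
    using assms(2) by (intro man_evade_winning) auto
  then show "\<exists>F. winning_man_strategy linf_ball linf_dist x0 y0 F"
    by blast
qed

end
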